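(* Let $\alpha>0$, let $0<\varepsilon_1<\dots<\varepsilon_n\le1$ with $\max_i\sqrt{\varepsilon_i}\le\sqrt\alpha/6$, and let $B^l_i(x)=e^{-x\sqrt{\alpha/\varepsilon_i}}$, $B^r_i(x)=B^l_i(1-x)$ for $x\in[0,1]$. For all $i,j$ with $1\le i<j\le n$ and all $0<s\le 3/2$, the point $x^{(s)}_{i,j}$ defined by $$\frac{B^l_i(x^{(s)}_{i,j})}{\varepsilon_i^s}=\frac{B^l_j(x^{(s)}_{i,j})}{\varepsilon_j^s}$$ exists, is uniquely defined, and satisfies $$\frac{B^l_i(x)}{\varepsilon_i^s}>\frac{B^l_j(x)}{\varepsilon_j^s}\ \text{ for }x\in[0,x^{(s)}_{i,j}),\qquad \frac{B^l_i(x)}{\varepsilon_i^s}<\frac{B^l_j(x)}{\varepsilon_j^s}\ \text{ for }x\in(x^{(s)}_{i,j},1].$$ Moreover $$x^{(s)}_{i,j}<x^{(s)}_{i+1,j}\ \text{ if } i+1<j,\qquad x^{(s)}_{i,j}<x^{(s)}_{i,j+1}\ \text{ if } i<j\ (\text{and } j+1\le n).$$ Also $$x^{(s)}_{i,j}<2s\sqrt{\frac{\varepsilon_j}{\alpha}}\quad\text{and}\quad x^{(s)}_{i,j}\in(0,\tfrac12)\quad\text{if } i<j.$$ Analogous results hold for $B^r_i$, $B^r_j$ and the points $1-x^{(s)}_{i,j}$: $1-x^{(s)}_{i,j}$ is the unique point $x$ of $[0,1]$ where $B^r_i(x)/\varepsilon_i^s=B^r_j(x)/\varepsilon_j^s$;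 $B^r_i(x)/\varepsilon_i^s>B^r_j(x)/\varepsilon_j^s$ for $x\in(1-x^{(s)}_{i,j},1]$ and $B^r_i(x)/\varepsilon_i^s<B^r_j(x)/\varepsilon_j^s$ for $x\in[0,1-x^{(s)}_{i,j})$; $1-x^{(s)}_{i,j}>1-x^{(s)}_{i+1,j}$ if $i+1<j$ and $1-x^{(s)}_{i,j}>1-x^{(s)}_{i,j+1}$ if $i<j$, $j+1\le n$; and $1-x^{(s)}_{i,j}>1-2s\sqrt{\varepsilon_j/\alpha}$, $1-x^{(s)}_{i,j}\in(\tfrac12,1)$.
   Context: The functions $B^l_i,B^r_i$ are the left and right boundary-layer functions of a singularly perturbed reaction-diffusion system with perturbation parameters $\varepsilon_1,\dots,\varepsilon_n$ and a constant $\alpha>0$; the statement uses only the definitions given in it. *)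

theory Defs
  imports Complex_Main
begin

text \<open>The perturbation parameters form a family \<open>\<epsilon>\<close>, of which only the indices
  \<open>1, \<dots>, n\<close> matter.\<close>

definition Bl :: "real \<Rightarrow> (nat \<Rightarrow> real) \<Rightarrow> nat \<Rightarrow> real \<Rightarrow> real" where
  "Bl \<alpha> \<epsilon> i x = exp (- x * sqrt (\<alpha> / \<epsilon> i))"

definition Br :: "real \<Rightarrow> (nat \<Rightarrow> real) \<Rightarrow> nat \<Rightarrow> real \<Rightarrow> real" where
  "Br \<alpha> \<epsilon> i x = Bl \<alpha> \<epsilon> i (1 - x)"

text \<open>This is meaningful only where exactly one such point of \<open>[0,1]\<close> exists;
  that has to be established separately.\<close>

definition crossing_point :: "real \<Rightarrow> (nat \<Rightarrow> real) \<Rightarrow> real \<Rightarrow> nat \<Rightarrow> nat \<Rightarrow> real" where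
  "crossing_point \<alpha> \<epsilon> s i j =
    (THE x. x \<in> {0..1} \<and> Bl \<alpha> \<epsilon> i x / \<epsilon> i powr s = Bl \<alpha> \<epsilon> j x / \<epsilon> j powr s)"

end

theory Submission
  imports Defs
begin

text \<open>Put \<open>a\<^sub>k = sqrt (\<alpha> / \<epsilon>\<^sub>k)\<close>. Since \<open>ln \<epsilon>\<^sub>k = ln \<alpha> - 2 ln a\<^sub>k\<close>, taking logarithms turns the
  comparison of the two weighted layer functions into the comparison of \<open>x\<close> with \<open>2 s\<close> times the
  slope \<open>(ln a\<^sub>i - ln a\<^sub>j) / (a\<^sub>i - a\<^sub>j)\<close> of a chord of the logarithm. By strict concavity this slope
  decreases in each endpoint and is less than \<open>1 / a\<^sub>j\<close>.\<close>

definition ln_chord :: "real \<Rightarrow> real \<Rightarrow> real" where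
  "ln_chord a b = (ln a - ln b) / (a - b)"

text \<open>The graph of \<open>ln\<close> lies strictly below its tangent at \<open>y\<close>,
  since \<open>ln t = t - 1\<close> only for \<open>t = 1\<close>. Neither order of \<open>x\<close>
  and \<open>y\<close> is imposed, so the bound serves on both sides of the point of
  tangency.\<close>

lemma ln_diff_less:
  fixes x y :: real
  assumes "0 < x" "0 < y" "x \<noteq> y"
  shows "ln x - ln y < (x - y) / y"
proof -
  have "ln (x / y) \<le> x / y - 1" "ln (x / y) \<noteq> x / y - 1"
    using ln_le_minus_one[of "x / y"] ln_eq_minus_one[of "x / y"] assms by auto
  then show ?thesis using assms by (simp add: ln_div diff_divide_distrib)
qed

lemma ln_chord_pos: "0 < b \<Longrightarrow> b < a \<Longrightarrow> 0 < ln_chord a b"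
  by (simp add: ln_chord_def)

lemma ln_chord_less:
  assumes "0 < b" "b < a"
  shows "ln_chord a b < 1 / b"
  using ln_diff_less[of a b] assms by (simp add: ln_chord_def field_simps)

text \<open>The slope over the whole interval from \<open>c\<close> to \<open>a\<close> is the
  mediant of the slopes over its two pieces, so it lies strictly between them once these are
  strictly ordered.\<close>

lemma ln_chord_strict_antimono:
  assumes "0 < c" "c < b" "b < a"
  shows "ln_chord a c < ln_chord b c" "ln_chord a b < ln_chord a c"
proof -
  define p q d e where "p = ln a - ln b" "q = ln b - ln c" "d = a - b" "e = b - c"
  note defs = this
  have d: "0 < d" and e: "0 < e" using assms by (auto simp: defs)
  \<comment> \<open>The tangent slope \<open>1 / b\<close> at the middle point separates the two
    pieces: \<open>p / d < 1 / b < q / e\<close>. Clearing denominators gives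
    \<open>p * e < d * q\<close>.\<close>
  have "p < d / b" using ln_diff_less[of a b] assms by (simp add: defs)
  then have "p * e < d / b * e" using e by (rule mult_strict_right_mono)
  moreover have "e / b < q"
    using ln_diff_less[of c b] assms by (simp add: defs diff_divide_distrib)
  then have "d * (e / b) < d * q" using d by (rule mult_strict_left_mono)
  ultimately have *: "p * e < d * q" by simp
  have chords: "ln_chord a b = p / d" "ln_chord b c = q / e" "ln_chord a c = (p + q) / (d + e)"
    by (simp_all add: ln_chord_def defs)
  then show "ln_chord a c < ln_chord b c" "ln_chord a b < ln_chord a c"
    unfolding chords using * d e by (simp_all add: divide_simps algebra_simps)
qed

text \<open>The term \<open>s * ln \<alpha>\<close> does not depend on \<open>k\<close>, so it
  cancels whenever two indices are compared.\<close>

lemma Bl_ratio_eq_exp: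
  assumes "0 < \<alpha>" "0 < \<epsilon> k"
  shows "Bl \<alpha> \<epsilon> k x / \<epsilon> k powr s
    = exp (2 * s * ln (sqrt (\<alpha> / \<epsilon> k)) - x * sqrt (\<alpha> / \<epsilon> k) - s * ln \<alpha>)"
proof -
  have "2 * ln (sqrt (\<alpha> / \<epsilon> k)) = ln \<alpha> - ln (\<epsilon> k)"
    using assms by (simp add: ln_sqrt ln_div)
  then have "2 * s * ln (sqrt (\<alpha> / \<epsilon> k)) = s * ln \<alpha> - s * ln (\<epsilon> k)"
    by (metis mult.assoc mult.commute right_diff_distrib)
  then show ?thesis using assms by (simp add: Bl_def powr_def exp_diff[symmetric])
qed

text \<open>The difference of the two exponents is affine in \<open>x\<close> with negative leading
  coefficient, so its only zero \<open>p\<close> decides the sign on the whole real line.\<close>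

lemma Bl_ratio_compare:
  fixes s x :: real
  assumes "0 < \<alpha>" "0 < \<epsilon> i" "\<epsilon> i < \<epsilon> j"
  defines "p \<equiv> 2 * s * ln_chord (sqrt (\<alpha> / \<epsilon> i)) (sqrt (\<alpha> / \<epsilon> j))"
  shows "Bl \<alpha> \<epsilon> i x / \<epsilon> i powr s > Bl \<alpha> \<epsilon> j x / \<epsilon> j powr s \<longleftrightarrow> x < p"
    and "Bl \<alpha> \<epsilon> i x / \<epsilon> i powr s < Bl \<alpha> \<epsilon> j x / \<epsilon> j powr s \<longleftrightarrow> p < x"
    and "Bl \<alpha> \<epsilon> i x / \<epsilon> i powr s = Bl \<alpha> \<epsilon> j x / \<epsilon> j powr s \<longleftrightarrow> x = p"
proof -
  define a b where "a = sqrt (\<alpha> / \<epsilon> i)" "b = sqrt (\<alpha> / \<epsilon> j)"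
  note ab = this
  have d: "0 < a - b" using assms by (simp add: ab field_simps)
  have Li: "Bl \<alpha> \<epsilon> i x / \<epsilon> i powr s = exp (2 * s * ln a - x * a - s * ln \<alpha>)"
    and Lj: "Bl \<alpha> \<epsilon> j x / \<epsilon> j powr s = exp (2 * s * ln b - x * b - s * ln \<alpha>)"
    using assms by (simp_all add: Bl_ratio_eq_exp ab)
  have p: "p = 2 * s * (ln a - ln b) / (a - b)" by (simp add: p_def ln_chord_def ab)
  show "Bl \<alpha> \<epsilon> i x / \<epsilon> i powr s > Bl \<alpha> \<epsilon> j x / \<epsilon> j powr s \<longleftrightarrow> x < p"
    unfolding Li Lj p pos_less_divide_eq[OF d] exp_less_cancel_iff
    by (auto simp: algebra_simps)
  show "Bl \<alpha> \<epsilon> i x / \<epsilon> i powr s < Bl \<alpha> \<epsilon> j x / \<epsilon> j powr s \<longleftrightarrow> p < x"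
    unfolding Li Lj p pos_divide_less_eq[OF d] exp_less_cancel_iff
    by (auto simp: algebra_simps)
  show "Bl \<alpha> \<epsilon> i x / \<epsilon> i powr s = Bl \<alpha> \<epsilon> j x / \<epsilon> j powr s \<longleftrightarrow> x = p"
    using d unfolding Li Lj p exp_inj_iff by (auto simp: field_simps)
qed

text \<open>At most one real solution exists; its membership in \<open>{0..1}\<close> is what makes
  the description by \<open>THE\<close> proper.\<close>

lemma crossing_point_eq:
  assumes "0 < \<alpha>" "0 < \<epsilon> i" "\<epsilon> i < \<epsilon> j"
    and "2 * s * ln_chord (sqrt (\<alpha> / \<epsilon> i)) (sqrt (\<alpha> / \<epsilon> j)) \<in> {0..1}"
  shows "crossing_point \<alpha> \<epsilon> s i j = 2 * s * ln_chord (sqrt (\<alpha> / \<epsilon> i)) (sqrt (\<alpha> / \<epsilon> j))"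
  unfolding crossing_point_def Bl_ratio_compare(3)[OF assms(1-3)]
  using assms(4) by (intro the_equality) auto

theorem lemma5:
  fixes \<alpha> s :: real and \<epsilon> :: "nat \<Rightarrow> real" and n i j :: nat
  defines "L \<equiv> \<lambda>k x. Bl \<alpha> \<epsilon> k x / \<epsilon> k powr s"
  defines "R \<equiv> \<lambda>k x. Br \<alpha> \<epsilon> k x / \<epsilon> k powr s"
  defines "X \<equiv> crossing_point \<alpha> \<epsilon> s"
  assumes "\<alpha> > 0"
    and "n \<ge> 1"
    and "0 < \<epsilon> 1" and "strict_mono_on {1..n} \<epsilon>" and "\<epsilon> n \<le> 1"
    and "(MAX k\<in>{1..n}. sqrt (\<epsilon> k)) \<le> sqrt \<alpha> / 6"
    and "1 \<le> i" and "i < j" and "j \<le> n"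
    and "0 < s" and "s \<le> 3 / 2"
  shows
    "(\<exists>!x. x \<in> {0..1} \<and> L i x = L j x) \<and>
     (\<forall>x\<in>{0..<X i j}. L i x > L j x) \<and>
     (\<forall>x\<in>{X i j<..1}. L i x < L j x) \<and>
     (i + 1 < j \<longrightarrow> X i j < X (i + 1) j) \<and>
     (j + 1 \<le> n \<longrightarrow> X i j < X i (j + 1)) \<and>
     X i j < 2 * s * sqrt (\<epsilon> j / \<alpha>) \<and>
     X i j \<in> {0<..<1/2} \<and>
     (\<forall>x. x \<in> {0..1} \<and> R i x = R j x \<longleftrightarrow> x = 1 - X i j) \<and>
     (\<forall>x\<in>{1 - X i j<..1}. R i x > R j x) \<and>
     (\<forall>x\<in>{0..<1 - X i j}. R i x < R j x) \<and>
     (i + 1 < j \<longrightarrow> 1 - X i j > 1 - X (i + 1) j) \<and>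
     (j + 1 \<le> n \<longrightarrow> 1 - X i j > 1 - X i (j + 1)) \<and>
     1 - X i j > 1 - 2 * s * sqrt (\<epsilon> j / \<alpha>) \<and>
     1 - X i j \<in> {1/2<..<1}"
proof -
  define a where "a k = sqrt (\<alpha> / \<epsilon> k)" for k
  note incr = strict_mono_onD[OF \<open>strict_mono_on {1..n} \<epsilon>\<close>]
  have pos: "0 < \<epsilon> k" if "k \<in> {1..n}" for k
    using incr[of 1 k] \<open>0 < \<epsilon> 1\<close> that by (cases "k = 1") auto
  have less: "\<epsilon> k < \<epsilon> l" if "1 \<le> k" "k < l" "l \<le> n" for k l
    using incr[of k l] that by auto
  have a_less: "a l < a k" if "1 \<le> k" "k < l" "l \<le> n" for k l
    using less[OF that] pos[of k] \<open>\<alpha> > 0\<close> that by (simp add: a_def field_simps)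
  have a_ge: "6 \<le> a k" if "k \<in> {1..n}" for k
  proof -
    have "sqrt (\<epsilon> k) \<le> (MAX k\<in>{1..n}. sqrt (\<epsilon> k))" using that by (intro Max_ge) auto
    also note \<open>\<dots> \<le> sqrt \<alpha> / 6\<close>
    finally show ?thesis using pos[OF that] by (simp add: a_def real_sqrt_divide field_simps)
  qed
  have p_less: "2 * s * ln_chord (a k) (a l) < 2 * s * (1 / a l)"
    and p_pos: "0 < 2 * s * ln_chord (a k) (a l)"
    and p_half: "2 * s * ln_chord (a k) (a l) < 1 / 2"
    if "1 \<le> k" "k < l" "l \<le> n" for k l
  proof -
    have l: "6 \<le> a l" using that by (intro a_ge) auto
    then have "0 < a l" by simp
    then show "0 < 2 * s * ln_chord (a k) (a l)"
      using ln_chord_pos a_less[OF that] \<open>0 < s\<close> by simp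
    show lt: "2 * s * ln_chord (a k) (a l) < 2 * s * (1 / a l)"
      using ln_chord_less[OF \<open>0 < a l\<close> a_less[OF that]] \<open>0 < s\<close>
      by (intro mult_strict_left_mono) auto
    \<comment> \<open>Here \<open>2 * s \<le> 3\<close> meets \<open>1 / a l \<le> 1 / 6\<close>,
      which yields the bound \<open>1 / 2\<close>; strictness comes from \<open>lt\<close>.\<close>
    have "2 * s * (1 / a l) \<le> 3 * (1 / 6)"
      using l \<open>s \<le> 3 / 2\<close> by (intro mult_mono) (auto simp: field_simps)
    with lt show "2 * s * ln_chord (a k) (a l) < 1 / 2" by simp
  qed
  \<comment> \<open>Stated for all pairs, because the monotonicity claims also involve
    \<open>(i + 1, j)\<close> and \<open>(i, j + 1)\<close>.\<close>
  have X: "X k l = 2 * s * ln_chord (a k) (a l)" if "1 \<le> k" "k < l" "l \<le> n" for k l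
    unfolding X_def a_def using p_pos[OF that] p_half[OF that] less[OF that] pos[of k] that \<open>\<alpha> > 0\<close>
    by (intro crossing_point_eq) (auto simp: a_def)
  have ij: "1 \<le> i" "i < j" "j \<le> n" by fact+
  have "0 < \<epsilon> i" using pos ij by simp
  note cmp = Bl_ratio_compare[OF \<open>\<alpha> > 0\<close> \<open>0 < \<epsilon> i\<close> less[OF ij], of _ s, folded a_def, folded X[OF ij]]
  have L: "L i x > L j x \<longleftrightarrow> x < X i j" "L i x < L j x \<longleftrightarrow> X i j < x"
    "L i x = L j x \<longleftrightarrow> x = X i j" for x
    unfolding L_def by (fact cmp)+
  \<comment> \<open>The reflection of \<open>x\<close> to \<open>1 - x\<close> reduces every claim
    on the right layers to one on the left layers.\<close>
  have R: "R k x = L k (1 - x)" for k x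
    by (simp add: R_def L_def Br_def)
  \<comment> \<open>As \<open>a\<close> decreases in its index, raising \<open>i\<close> or
    \<open>j\<close> moves one endpoint of the chord to the left, where the logarithm is
    steeper.\<close>
  have "X i j < X (i + 1) j" if "i + 1 < j"
    using ln_chord_strict_antimono(1)[of "a j" "a (i + 1)" "a i"] a_ge[of j] a_less ij that \<open>0 < s\<close>
    by (simp add: X)
  moreover have "X i j < X i (j + 1)" if "j + 1 \<le> n"
    using ln_chord_strict_antimono(2)[of "a (j + 1)" "a j" "a i"] a_ge[of "j + 1"] a_less ij that \<open>0 < s\<close>
    by (simp add: X)
  moreover have "X i j < 2 * s * sqrt (\<epsilon> j / \<alpha>)"
    using p_less[OF ij] by (simp add: X[OF ij] a_def real_sqrt_divide)
  moreover have "0 < X i j" "X i j < 1 / 2"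
    using p_pos[OF ij] p_half[OF ij] by (simp_all add: X[OF ij])
  ultimately show ?thesis unfolding R L by auto
qed

end
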